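(* Let $s_{21},s_{32},s_{31}\in\mathbb{R}\cup\{-\infty\}$ with $-\infty\le s_{ij}<0$ for all $i\neq j$, and let $$P=X^{\odot 2}\oplus Y^{\odot 2}\oplus Z^{\odot 2}\oplus s_{21}\odot X\odot Y\oplus s_{32}\odot Y\odot Z\oplus s_{31}\odot X\odot Z .$$ Then the polynomial $P$ is irreducible, but the tropical conic $\mathcal{C}(P)$ is a double line.
   Context: $\mathbb{T}=\mathbb{R}\cup\{-\infty\}$ with $a\oplus b=\max\{a,b\}$, $a\odot b=a+b$. A tropical polynomial in $X,Y,Z$ is a formal polynomial with coefficients in $\mathbb{T}$ (a monomial with coefficient $-\infty$ is absent; a monomial written without coefficient has coefficient $0$); products are computed formally, coefficient by coefficient. We put $s_{ij}=s_{ji}$. A tropical polynomial is reducible if it is the tropical product of two non-constant tropical polynomials, and irreducible otherwise. $\mathbb{T}\mathbb{P}^2$ is the set of classes $[b_1,b_2,b_3]$ of triples in $\mathbb{T}^3\setminus\{(-\infty,-\infty,-\infty)\}$ under adding a real multiple of $(1,1,1)$. The tropical conic $\mathcal{C}(P)$ is the set of points of $\mathbb{T}\mathbb{P}^2$ at which $\max\{2X,2Y,2Z,s_{21}+X+Y,s_{32}+Y+Z,s_{31}+X+Z\}$ is attained by at least two of the six terms. A tropical line is the set of points of $\mathbb{T}\mathbb{P}^2$ at which $\max\{\alpha+X,\beta+Y,\gamma+Z\}$ is attained at least twice, for some $\alpha,\beta,\gamma\in\mathbb{R}$. A double line is a conic which, as a set, is a tropical line, all of whose edges have multiplicity two; the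 multiplicity of an edge $e$ of the conic is the lattice length of the convex hull of the exponent vectors of those terms of the polynomial that attain the maximum at the points of the relative interior of $e$. *)

theory Defs
  imports "HOL-Analysis.Analysis" "HOL-Library.Poly_Mapping"
begin

section \<open>The tropical semiring\<close>

datatype trop = NegInf | Fin real

text \<open>
  The type class operations carry the tropical structure: \<open>+\<close> is the maximum and \<open>*\<close> is the
  addition of reals, so the class constant \<open>0\<close> is \<open>NegInf\<close> and the class constant \<open>1\<close> is \<open>Fin 0\<close>;
  moreover \<open>Fin x ^ n = Fin (n * x)\<close> and \<open>NegInf ^ 0 = Fin 0\<close>.
\<close>

instantiation trop :: linorder
begin

fun less_eq_trop :: "trop \<Rightarrow> trop \<Rightarrow> bool" where
  "NegInf \<le> (b::trop) \<longleftrightarrow> True"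
| "Fin x \<le> NegInf \<longleftrightarrow> False"
| "Fin x \<le> Fin y \<longleftrightarrow> x \<le> y"

definition less_trop :: "trop \<Rightarrow> trop \<Rightarrow> bool" where
  "less_trop a b \<longleftrightarrow> a \<le> b \<and> \<not> b \<le> a"

instance
proof
  fix a b c :: trop
  show "a < b \<longleftrightarrow> a \<le> b \<and> \<not> b \<le> a" by (rule less_trop_def)
  show "a \<le> a" by (cases a) simp_all
  show "a \<le> c" if "a \<le> b" "b \<le> c" using that by (cases a; cases b; cases c) auto
  show "a = b" if "a \<le> b" "b \<le> a" using that by (cases a; cases b) auto
  show "a \<le> b \<or> b \<le> a" by (cases a; cases b) auto
qed

end

instantiation trop :: comm_semiring_1
begin

definition zero_trop :: trop where "(0::trop) = NegInf"

definition one_trop :: trop where "(1::trop) = Fin 0"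

definition plus_trop :: "trop \<Rightarrow> trop \<Rightarrow> trop" where "(a::trop) + b = max a b"

fun times_trop :: "trop \<Rightarrow> trop \<Rightarrow> trop" where
  "Fin x * Fin y = Fin (x + y)"
| "NegInf * b = NegInf"
| "Fin x * NegInf = NegInf"

instance
proof
  fix a b c :: trop
  show "a * b * c = a * (b * c)" by (cases a; cases b; cases c) auto
  show "a * b = b * a" by (cases a; cases b) auto
  show "1 * a = a" by (cases a) (auto simp: one_trop_def)
  show "a + b + c = a + (b + c)" by (simp add: plus_trop_def max.assoc)
  show "a + b = b + a" by (simp add: plus_trop_def max.commute)
  show "0 + a = a" by (simp add: plus_trop_def zero_trop_def max_def)
  show "0 * a = 0" by (simp add: zero_trop_def)
  show "a * 0 = 0" by (cases a) (auto simp: zero_trop_def)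
  show "(a + b) * c = a * c + b * c"
    by (cases a; cases b; cases c) (auto simp: plus_trop_def max_def)
  show "(0::trop) \<noteq> 1" by (simp add: zero_trop_def one_trop_def)
qed

end

section \<open>Tropical polynomials in three variables\<close>

text \<open>
  The exponent vector \<open>(i, j, k)\<close> stands for \<open>X\<^sup>i Y\<^sup>j Z\<^sup>k\<close>. A monomial with coefficient \<open>NegInf\<close> is
  not in \<open>keys\<close>. The ring operations of \<^type>\<open>poly_mapping\<close> are the formal (coefficientwise)
  tropical sum and product.
\<close>

type_synonym trop_poly = "(nat \<times> nat \<times> nat) \<Rightarrow>\<^sub>0 trop"

definition const_poly :: "trop \<Rightarrow> trop_poly" where
  "const_poly a = Poly_Mapping.single (0, 0, 0) a"

definition varX :: trop_poly where "varX = Poly_Mapping.single (1, 0, 0) 1"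

definition varY :: trop_poly where "varY = Poly_Mapping.single (0, 1, 0) 1"

definition varZ :: trop_poly where "varZ = Poly_Mapping.single (0, 0, 1) 1"

definition is_constant :: "trop_poly \<Rightarrow> bool" where
  "is_constant p \<longleftrightarrow> (\<exists>a. p = const_poly a)"

definition homogeneous :: "nat \<Rightarrow> trop_poly \<Rightarrow> bool" where
  "homogeneous d p \<longleftrightarrow> (\<forall>(i, j, k) \<in> Poly_Mapping.keys p. i + j + k = d)"

definition trop_reducible :: "trop_poly \<Rightarrow> bool" where
  "trop_reducible p \<longleftrightarrow> (\<exists>q r. \<not> is_constant q \<and> \<not> is_constant r \<and> p = q * r)"

definition trop_irreducible :: "trop_poly \<Rightarrow> bool" where
  "trop_irreducible p \<longleftrightarrow> \<not> trop_reducible p"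

fun term_value :: "trop_poly \<Rightarrow> nat \<times> nat \<times> nat \<Rightarrow> trop \<times> trop \<times> trop \<Rightarrow> trop" where
  "term_value p (i, j, k) (x, y, z) = Poly_Mapping.lookup p (i, j, k) * x ^ i * y ^ j * z ^ k"

text \<open>The exponent vectors of the terms of \<open>p\<close> that attain the maximum at \<open>b\<close>.\<close>

definition maximal_terms :: "trop_poly \<Rightarrow> trop \<times> trop \<times> trop \<Rightarrow> (nat \<times> nat \<times> nat) set" where
  "maximal_terms p b = {m \<in> Poly_Mapping.keys p. \<forall>n \<in> Poly_Mapping.keys p. term_value p n b \<le> term_value p m b}"

section \<open>The tropical projective plane and its curves\<close>

definition proj_rel :: "((trop \<times> trop \<times> trop) \<times> (trop \<times> trop \<times> trop)) set" where
  "proj_rel = {((x, y, z), (x', y', z')).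
     (x, y, z) \<noteq> (NegInf, NegInf, NegInf) \<and> (x', y', z') \<noteq> (NegInf, NegInf, NegInf) \<and>
     (\<exists>t::real. x' = Fin t * x \<and> y' = Fin t * y \<and> z' = Fin t * z)}"

definition TP2 :: "(trop \<times> trop \<times> trop) set set" where
  "TP2 = (UNIV - {(NegInf, NegInf, NegInf)}) // proj_rel"

text \<open>
  For homogeneous \<open>p\<close> the set \<open>maximal_terms p b\<close> does not depend on the representative \<open>b\<close> of a
  point of \<open>TP2\<close> (see \<open>maximal_terms_proj_rel\<close> below).
\<close>

definition trop_curve :: "trop_poly \<Rightarrow> (trop \<times> trop \<times> trop) set set" where
  "trop_curve p = {q \<in> TP2. \<exists>b \<in> q. card (maximal_terms p b) \<ge> 2}"

definition tropical_line :: "(trop \<times> trop \<times> trop) set set \<Rightarrow> bool" where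
  "tropical_line L \<longleftrightarrow> (\<exists>\<alpha> \<beta> \<gamma> :: real.
     L = trop_curve (const_poly (Fin \<alpha>) * varX + const_poly (Fin \<beta>) * varY
                     + const_poly (Fin \<gamma>) * varZ))"

section \<open>Edges and multiplicities\<close>

text \<open>
  The points of \<open>TP2\<close> with finite coordinates are identified with the real plane through
  \<open>(x, y) \<mapsto> [x, y, 0]\<close>. The polynomial subdivides this plane into closed convex polyhedral cells,
  on whose relative interiors the set of maximal terms is constant; the edges of the curve are the
  one-dimensional cells. The closure of an unbounded edge in \<open>TP2\<close> has further end points at
  infinity, which do not belong to its relative interior.
\<close>

definition chart_terms :: "trop_poly \<Rightarrow> real \<times> real \<Rightarrow> (nat \<times> nat \<times> nat) set" where
  "chart_terms p w = maximal_terms p (Fin (fst w), Fin (snd w), Fin 0)"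

definition cell :: "trop_poly \<Rightarrow> real \<times> real \<Rightarrow> (real \<times> real) set" where
  "cell p w = {v. chart_terms p w \<subseteq> chart_terms p v}"

definition edges :: "trop_poly \<Rightarrow> (real \<times> real) set set" where
  "edges p = {e. \<exists>w. e = cell p w \<and> aff_dim e = 1}"

definition exponent_vector :: "nat \<times> nat \<times> nat \<Rightarrow> real \<times> real \<times> real" where
  "exponent_vector = (\<lambda>(i, j, k). (real i, real j, real k))"

text \<open>
  A segment with end points in the lattice of integer points has one more lattice point than its
  lattice length.
\<close>

definition lattice_length :: "(real \<times> real \<times> real) set \<Rightarrow> nat" where
  "lattice_length S = card (S \<inter> (\<int> \<times> \<int> \<times> \<int>)) - 1"

definition multiplicity :: "trop_poly \<Rightarrow> (real \<times> real) set \<Rightarrow> nat" where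
  "multiplicity p e = lattice_length (convex hull
     (exponent_vector ` {m. \<forall>v \<in> rel_interior e. m \<in> chart_terms p v}))"

text \<open>Multiplicities depend on the polynomial and not just on the point set it defines.\<close>

definition double_line :: "trop_poly \<Rightarrow> bool" where
  "double_line p \<longleftrightarrow> homogeneous 2 p \<and> tropical_line (trop_curve p) \<and>
     (\<forall>e \<in> edges p. multiplicity p e = 2)"

section \<open>Independence of the representative\<close>

lemma Fin_power: "Fin t ^ n = Fin (real n * t)"
  by (induction n) (auto simp: one_trop_def algebra_simps)

lemma Fin_mult_le_iff: "Fin t * a \<le> Fin t * b \<longleftrightarrow> a \<le> b"
  by (cases a; cases b) auto

lemma term_value_scale:
  "term_value p (i, j, k) (Fin t * x, Fin t * y, Fin t * z) =
     Fin (real (i + j + k) * t) * term_value p (i, j, k) (x, y, z)"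
proof -
  have "Fin (real (i + j + k) * t) = Fin t ^ i * Fin t ^ j * Fin t ^ k"
    by (simp add: Fin_power algebra_simps)
  then show ?thesis by (simp add: power_mult_distrib mult_ac)
qed

lemma maximal_terms_proj_rel:
  assumes "homogeneous d p" and "(b, c) \<in> proj_rel"
  shows "maximal_terms p c = maximal_terms p b"
proof -
  obtain x y z t where b: "b = (x, y, z)" and c: "c = (Fin t * x, Fin t * y, Fin t * z)"
    using assms(2) unfolding proj_rel_def by auto
  have *: "term_value p m c = Fin (real d * t) * term_value p m b" if "m \<in> Poly_Mapping.keys p" for m
    using that assms(1) term_value_scale[of p "fst m" "fst (snd m)" "snd (snd m)" t x y z]
    by (force simp: b c homogeneous_def)
  show ?thesis
    unfolding maximal_terms_def using * by (auto simp: Fin_mult_le_iff)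
qed

lemma equiv_proj_rel: "equiv (UNIV - {(NegInf, NegInf, NegInf)}) proj_rel"
proof (rule equivI)
  have one: "Fin 0 * a = a" for a by (cases a) auto
  have inv: "Fin (- t) * (Fin t * a) = a" for t a by (cases a) auto
  have add: "Fin t * (Fin u * a) = Fin (t + u) * a" for t u a by (cases a) auto
  show "proj_rel \<subseteq> (UNIV - {(NegInf, NegInf, NegInf)}) \<times> (UNIV - {(NegInf, NegInf, NegInf)})"
    by (auto simp: proj_rel_def)
  show "refl_on (UNIV - {(NegInf, NegInf, NegInf)}) proj_rel"
    by (auto simp: proj_rel_def refl_on_def intro!: exI[of _ 0] simp: one)
  show "sym proj_rel"
  proof (rule symI)
    fix b c assume "(b, c) \<in> proj_rel"
    then obtain x y z t where "b = (x, y, z)" "c = (Fin t * x, Fin t * y, Fin t * z)"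
      and "b \<noteq> (NegInf, NegInf, NegInf)" "c \<noteq> (NegInf, NegInf, NegInf)"
      unfolding proj_rel_def by auto
    then show "(c, b) \<in> proj_rel"
      unfolding proj_rel_def by (simp, intro exI[of _ "- t"]) (simp add: inv)
  qed
  show "trans proj_rel"
    unfolding trans_def proj_rel_def by (auto simp: add)
qed

end

theory Submission
  imports Defs
begin

text \<open>
  In the tropical semiring sums never cancel, so both factors of a reducible homogeneous polynomial
  are homogeneous. Were \<open>P\<close> a product of linear forms with coefficients \<open>a\<close>, \<open>b\<close>, \<open>c\<close> and \<open>a'\<close>, \<open>b'\<close>,
  \<open>c'\<close>, the squares would force \<open>a + a' = b + b' = 0\<close>; then \<open>a + b'\<close> and \<open>b + a'\<close> have sum \<open>0\<close>, so their
  maximum, the coefficient of \<open>XY\<close>, is nonnegative. On the other hand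
  \<open>s\<^sub>2\<^sub>1 + X + Y < max (2X) (2Y)\<close> unless \<open>X = Y = -\<infinity>\<close>, and likewise for the other mixed terms, so these
  are never maximal: \<open>P\<close> attains its maximum twice exactly where \<open>max X Y Z\<close> does, with doubled
  exponents. Each of the three rays of this line is dual to the segment between two of the vectors
  \<open>(2, 0, 0)\<close>, \<open>(0, 2, 0)\<close>, \<open>(0, 0, 2)\<close>.
\<close>

section \<open>Irreducibility\<close>

lemma less_trop_iff:
  "NegInf < Fin x" "\<not> a < NegInf" "Fin x < Fin y \<longleftrightarrow> x < y"
  unfolding less_trop_def by auto

lemma trop_add_self: "(a::trop) + a = a"
  by (simp add: plus_trop_def)

text \<open>Addition is idempotent, so a term of \<open>p\<close> may be added once more; this makes
  a chosen term an explicit summand.\<close>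

lemma single_add_absorb:
  "Poly_Mapping.single m (Poly_Mapping.lookup p m) + p = (p :: trop_poly)"
  by (rule poly_mapping_eqI) (simp add: lookup_add lookup_single when_def trop_add_self)

text \<open>This is the absence of cancellation. Doubling one term in each factor leaves the product
  unchanged, and expanding shows the product of these terms as a summand; a tropical sum is at least
  each summand.\<close>

lemma lookup_mult_ge:
  fixes q r :: trop_poly
  shows "Poly_Mapping.lookup q m * Poly_Mapping.lookup r n \<le> Poly_Mapping.lookup (q * r) (m + n)"
proof -
  let ?a = "Poly_Mapping.single m (Poly_Mapping.lookup q m)"
  let ?b = "Poly_Mapping.single n (Poly_Mapping.lookup r n)"
  have "(?a + q) * (?b + r) = ?a * ?b + (?a * r + (q * ?b + q * r))"
    by (simp only: distrib_left distrib_right add.assoc add.left_commute)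
  then have "q * r = Poly_Mapping.single (m + n) (Poly_Mapping.lookup q m * Poly_Mapping.lookup r n)
      + (?a * r + (q * ?b + q * r))"
    by (simp only: single_add_absorb mult_single)
  then show ?thesis
    by (metis lookup_add lookup_single_eq plus_trop_def max.cobounded1)
qed

lemma keys_add_in_keys_mult:
  fixes q r :: trop_poly
  assumes "m \<in> Poly_Mapping.keys q" and "n \<in> Poly_Mapping.keys r"
  shows "m + n \<in> Poly_Mapping.keys (q * r)"
  using assms lookup_mult_ge[of q m r n]
  by (cases "Poly_Mapping.lookup q m"; cases "Poly_Mapping.lookup r n";
      cases "Poly_Mapping.lookup (q * r) (m + n)")
    (auto simp: in_keys_iff zero_trop_def)

lemma homogeneous_iff:
  "homogeneous d p \<longleftrightarrow> (\<forall>i j k. (i, j, k) \<in> Poly_Mapping.keys p \<longrightarrow> i + j + k = d)"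
  unfolding homogeneous_def by auto

lemma homogeneous_lookup_eq_0:
  assumes "homogeneous d p" and "i + j + k \<noteq> d"
  shows "Poly_Mapping.lookup p (i, j, k) = 0"
  using assms unfolding homogeneous_iff in_keys_iff by blast

lemma homogeneous_mult_degrees:
  assumes "homogeneous d (q * r)"
    and "(i, j, k) \<in> Poly_Mapping.keys q" and "(i', j', k') \<in> Poly_Mapping.keys r"
  shows "i + j + k + (i' + j' + k') = d"
proof -
  have "(i + i', j + j', k + k') \<in> Poly_Mapping.keys (q * r)"
    using keys_add_in_keys_mult[OF assms(2,3)] by (simp only: add_Pair)
  then have "(i + i') + (j + j') + (k + k') = d"
    using assms(1) unfolding homogeneous_iff by blast
  then show ?thesis by linarith
qed

text \<open>Fix one term in each factor. Every term of one factor, multiplied by the fixed term of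
  the other, survives in the product and so has degree \<open>d\<close>; hence all terms of a factor
  have equal degree.\<close>

lemma homogeneous_factors:
  assumes "homogeneous d (q * r)" and "q \<noteq> 0" and "r \<noteq> 0"
  obtains d1 d2 where "d1 + d2 = d" and "homogeneous d1 q" and "homogeneous d2 r"
proof -
  have "Poly_Mapping.keys q \<noteq> {}" "Poly_Mapping.keys r \<noteq> {}"
    using assms(2,3) by (simp_all only: keys_eq_empty not_False_eq_True)
  then obtain m n where "m \<in> Poly_Mapping.keys q" "n \<in> Poly_Mapping.keys r"
    by blast
  then obtain i j k i' j' k' where ijk: "(i, j, k) \<in> Poly_Mapping.keys q"
    and ijk': "(i', j', k') \<in> Poly_Mapping.keys r"
    by (cases m; cases n) blast
  note degrees = homogeneous_mult_degrees[OF assms(1)]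
  note d = degrees[OF ijk ijk']
  have "homogeneous (i + j + k) q"
    unfolding homogeneous_iff
  proof (intro allI impI)
    fix a b c assume "(a, b, c) \<in> Poly_Mapping.keys q"
    from degrees[OF this ijk'] d show "a + b + c = i + j + k" by linarith
  qed
  moreover have "homogeneous (i' + j' + k') r"
    unfolding homogeneous_iff
  proof (intro allI impI)
    fix a b c assume "(a, b, c) \<in> Poly_Mapping.keys r"
    from degrees[OF ijk this] d show "a + b + c = i' + j' + k'" by linarith
  qed
  ultimately show thesis using d that by blast
qed

lemma homogeneous_0_is_constant:
  assumes "homogeneous 0 p"
  shows "is_constant p"
  unfolding is_constant_def
proof
  show "p = const_poly (Poly_Mapping.lookup p (0, 0, 0))"
  proof (rule poly_mapping_eqI)
    fix m :: "nat \<times> nat \<times> nat"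
    have "Poly_Mapping.lookup p m = 0" if "m \<noteq> (0, 0, 0)"
      using assms that by (cases m) (simp add: homogeneous_lookup_eq_0)
    then show "Poly_Mapping.lookup p m =
        Poly_Mapping.lookup (const_poly (Poly_Mapping.lookup p (0, 0, 0))) m"
      by (auto simp: const_poly_def lookup_single when_def)
  qed
qed

lemma homogeneous_1_expand:
  assumes "homogeneous 1 p"
  obtains a b c where "p = Poly_Mapping.single (1, 0, 0) a + Poly_Mapping.single (0, 1, 0) b
    + Poly_Mapping.single (0, 0, 1) c"
proof
  let ?c = "Poly_Mapping.lookup p"
  show "p = Poly_Mapping.single (1, 0, 0) (?c (1, 0, 0)) + Poly_Mapping.single (0, 1, 0) (?c (0, 1, 0))
    + Poly_Mapping.single (0, 0, 1) (?c (0, 0, 1))"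
  proof (rule poly_mapping_eqI)
    fix m :: "nat \<times> nat \<times> nat"
    obtain i j k where m: "m = (i, j, k)" by (cases m)
    have "?c m = 0" if "i + j + k \<noteq> 1"
      using assms that by (simp add: m homogeneous_lookup_eq_0)
    moreover have "i + j + k = 1 \<longleftrightarrow> m \<in> {(1, 0, 0), (0, 1, 0), (0, 0, 1)}"
      by (auto simp: m)
    ultimately show "?c m = Poly_Mapping.lookup (Poly_Mapping.single (1, 0, 0) (?c (1, 0, 0))
        + Poly_Mapping.single (0, 1, 0) (?c (0, 1, 0)) + Poly_Mapping.single (0, 0, 1) (?c (0, 0, 1))) m"
      by (auto simp: lookup_add lookup_single when_def)
  qed
qed

lemma conic_irreducible:
  assumes hom: "homogeneous 2 p"
    and XX: "Poly_Mapping.lookup p (2, 0, 0) = 1"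
    and YY: "Poly_Mapping.lookup p (0, 2, 0) = 1"
    and XY: "Poly_Mapping.lookup p (1, 1, 0) < Fin 0"
  shows "trop_irreducible p"
  unfolding trop_irreducible_def trop_reducible_def
proof (intro notI, elim exE conjE)
  fix q r
  assume q: "\<not> is_constant q" and r: "\<not> is_constant r" and p: "p = q * r"
  \<comment> \<open>The zero polynomial is the constant -infinity.\<close>
  have "q \<noteq> 0" "r \<noteq> 0"
    using q r by (metis is_constant_def const_poly_def single_zero)+
  then obtain d1 d2 where d: "d1 + d2 = 2" "homogeneous d1 q" "homogeneous d2 r"
    using homogeneous_factors hom p by metis
  moreover have "d1 \<noteq> 0" "d2 \<noteq> 0"
    using d q r homogeneous_0_is_constant by metis+
  ultimately have "d1 = 1" "d2 = 1" by linarith+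
  with d have "homogeneous 1 q" "homogeneous 1 r" by simp_all
  then obtain a b c a' b' c' where
    "q = Poly_Mapping.single (1, 0, 0) a + Poly_Mapping.single (0, 1, 0) b
      + Poly_Mapping.single (0, 0, 1) c"
    "r = Poly_Mapping.single (1, 0, 0) a' + Poly_Mapping.single (0, 1, 0) b'
      + Poly_Mapping.single (0, 0, 1) c'"
    by (metis homogeneous_1_expand)
  then have "Poly_Mapping.lookup p (2, 0, 0) = a * a'" "Poly_Mapping.lookup p (0, 2, 0) = b * b'"
    "Poly_Mapping.lookup p (1, 1, 0) = max (a * b') (b * a')"
    by (simp_all add: p distrib_left distrib_right mult_single lookup_add lookup_single when_def
        add_ac flip: plus_trop_def)
  \<comment> \<open>The squares have coefficient \<open>Fin 0\<close>, which excludes -infinity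
    among \<open>a\<close>, \<open>a'\<close>, \<open>b\<close>, \<open>b'\<close>; what remains is
    linear arithmetic over the reals.\<close>
  then show False
    using XX YY XY
    by (cases a; cases a'; cases b; cases b')
      (auto simp: one_trop_def less_trop_iff max_def split: if_splits)
qed

section \<open>The terms that attain the maximum\<close>

definition squares :: "(nat \<times> nat \<times> nat) set" where
  "squares = {(2, 0, 0), (0, 2, 0), (0, 0, 2)}"

text \<open>These are the positions of the largest coordinates, written as exponent vectors of X, Y,
  Z so that doubling yields the exponents of the squares.\<close>

definition leading_coords :: "'a::linorder \<times> 'a \<times> 'a \<Rightarrow> (nat \<times> nat \<times> nat) set" where
  "leading_coords = (\<lambda>(x, y, z). {m. m = (1, 0, 0) \<and> y \<le> x \<and> z \<le> x
     \<or> m = (0, 1, 0) \<and> x \<le> y \<and> z \<le> y \<or> m = (0, 0, 1) \<and> x \<le> z \<and> y \<le> z})"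

lemma leading_coords_subset_iff:
  "leading_coords (x, y, z) \<subseteq> S \<longleftrightarrow> (y \<le> x \<and> z \<le> x \<longrightarrow> (1, 0, 0) \<in> S)
     \<and> (x \<le> y \<and> z \<le> y \<longrightarrow> (0, 1, 0) \<in> S) \<and> (x \<le> z \<and> y \<le> z \<longrightarrow> (0, 0, 1) \<in> S)"
  unfolding leading_coords_def prod.case by blast

lemma double_leading_coords:
  "(\<lambda>m. m + m) ` leading_coords (x, y, z) = {m. m = (2, 0, 0) \<and> y \<le> x \<and> z \<le> x
     \<or> m = (0, 2, 0) \<and> x \<le> y \<and> z \<le> y \<or> m = (0, 0, 2) \<and> x \<le> z \<and> y \<le> z}"
proof -
  have image: "f ` {m. m = a \<and> A \<or> m = b \<and> B \<or> m = c \<and> C} = {m. m = f a \<and> A \<or> m = f b \<and> B \<or> m = f c \<and> C}"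
    for f :: "nat \<times> nat \<times> nat \<Rightarrow> nat \<times> nat \<times> nat" and a b c A B C
    by blast
  show ?thesis unfolding leading_coords_def prod.case image by (simp add: numeral_2_eq_2)
qed

text \<open>Injectivity lets doubling preserve both the number of maximal terms and the inclusions
  that define cells.\<close>

lemma inj_double: "inj (\<lambda>m :: nat \<times> nat \<times> nat. m + m)"
proof (rule injI)
  fix m n :: "nat \<times> nat \<times> nat"
  assume "m + m = n + n"
  then show "m = n" by (cases m; cases n) simp
qed

lemma trop_square_le_iff: "(x::trop)\<^sup>2 \<le> y\<^sup>2 \<longleftrightarrow> x \<le> y"
  by (cases x; cases y) (auto simp: power2_eq_square)

text \<open>If all factors are finite, s + x + y < x + y, which is at most twice the larger of x and
  y. Otherwise the product is -infinity and lies below the square of any finite coordinate, possibly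
  only that of \<open>z\<close>.\<close>

lemma mixed_term_less:
  assumes "s < Fin 0" and "(x, y, z) \<noteq> (NegInf, NegInf, NegInf)"
  shows "s * x * y < x\<^sup>2 \<or> s * x * y < y\<^sup>2 \<or> s * x * y < z\<^sup>2"
  using assms
  by (cases s; cases x; cases y; cases z) (auto simp: power2_eq_square less_trop_iff)

text \<open>A term strictly beaten by one in \<open>S\<close> is never maximal, and a bound for the
  terms in \<open>S\<close> bounds it as well.\<close>

lemma maximal_terms_dominated:
  assumes S: "S \<subseteq> Poly_Mapping.keys p"
    and dom: "\<And>n. n \<in> Poly_Mapping.keys p - S \<Longrightarrow> \<exists>m \<in> S. term_value p n b < term_value p m b"
  shows "maximal_terms p b = {m \<in> S. \<forall>n \<in> S. term_value p n b \<le> term_value p m b}"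
proof (intro set_eqI iffI)
  fix m assume m: "m \<in> maximal_terms p b"
  have "m \<in> S"
  proof (rule ccontr)
    assume "m \<notin> S"
    with dom m obtain n where "n \<in> S" "term_value p m b < term_value p n b"
      unfolding maximal_terms_def by blast
    with S m show False
      unfolding maximal_terms_def by (metis (mono_tags, lifting) mem_Collect_eq not_le subsetD)
  qed
  with S m show "m \<in> {m \<in> S. \<forall>n \<in> S. term_value p n b \<le> term_value p m b}"
    unfolding maximal_terms_def by blast
next
  fix m assume m: "m \<in> {m \<in> S. \<forall>n \<in> S. term_value p n b \<le> term_value p m b}"
  have "term_value p n b \<le> term_value p m b" if "n \<in> Poly_Mapping.keys p" for n
  proof (cases "n \<in> S")
    case False
    with dom that obtain m' where "m' \<in> S" "term_value p n b < term_value p m' b"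
      by blast
    moreover from this m have "term_value p m' b \<le> term_value p m b" by blast
    ultimately show ?thesis by (blast intro: less_imp_le order_trans)
  qed (use m in blast)
  with S m show "m \<in> maximal_terms p b"
    unfolding maximal_terms_def by blast
qed

lemma maximal_terms_line:
  "maximal_terms (const_poly (Fin 0) * varX + const_poly (Fin 0) * varY + const_poly (Fin 0) * varZ) b
    = leading_coords b"
proof -
  let ?L = "const_poly (Fin 0) * varX + const_poly (Fin 0) * varY + const_poly (Fin 0) * varZ"
  have L: "?L = Poly_Mapping.single (1, 0, 0) 1 + Poly_Mapping.single (0, 1, 0) 1
      + Poly_Mapping.single (0, 0, 1) 1"
    by (simp add: const_poly_def varX_def varY_def varZ_def mult_single one_trop_def)
  have keys: "Poly_Mapping.keys ?L = {(1, 0, 0), (0, 1, 0), (0, 0, 1)}"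
    unfolding L by (auto simp: in_keys_iff lookup_add lookup_single when_def split: if_splits)
  obtain x y z where b: "b = (x, y, z)" by (cases b)
  have "term_value ?L (1, 0, 0) b = x" "term_value ?L (0, 1, 0) b = y" "term_value ?L (0, 0, 1) b = z"
    unfolding L b by (simp_all add: lookup_add lookup_single)
  then show ?thesis
    unfolding maximal_terms_def keys leading_coords_def b by auto
qed

section \<open>The conic compared with the line of max(X, Y, Z)\<close>

locale conic =
  fixes s21 s32 s31 :: trop and P :: trop_poly
  assumes neg: "s21 < Fin 0" "s32 < Fin 0" "s31 < Fin 0"
    and P: "P = varX ^ 2 + varY ^ 2 + varZ ^ 2 + const_poly s21 * varX * varY
             + const_poly s32 * varY * varZ + const_poly s31 * varX * varZ"
begin

lemma P_singles:
  "P = Poly_Mapping.single (2, 0, 0) 1 + Poly_Mapping.single (0, 2, 0) 1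
     + Poly_Mapping.single (0, 0, 2) 1 + Poly_Mapping.single (1, 1, 0) s21
     + Poly_Mapping.single (0, 1, 1) s32 + Poly_Mapping.single (1, 0, 1) s31"
  by (simp add: P const_poly_def varX_def varY_def varZ_def mult_single power2_eq_square numeral_2_eq_2)

lemma lookup_P:
  "Poly_Mapping.lookup P (2, 0, 0) = 1" "Poly_Mapping.lookup P (0, 2, 0) = 1"
  "Poly_Mapping.lookup P (0, 0, 2) = 1" "Poly_Mapping.lookup P (1, 1, 0) = s21"
  "Poly_Mapping.lookup P (0, 1, 1) = s32" "Poly_Mapping.lookup P (1, 0, 1) = s31"
  by (simp_all add: P_singles lookup_add lookup_single)

text \<open>The support is only enclosed between two sets, because a mixed monomial is absent when
  its coefficient is -infinity.\<close>

lemma keys_P: "squares \<subseteq> Poly_Mapping.keys P"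
  "Poly_Mapping.keys P \<subseteq> squares \<union> {(1, 1, 0), (0, 1, 1), (1, 0, 1)}"
proof -
  show "squares \<subseteq> Poly_Mapping.keys P"
    by (auto simp: squares_def in_keys_iff lookup_P)
  show "Poly_Mapping.keys P \<subseteq> squares \<union> {(1, 1, 0), (0, 1, 1), (1, 0, 1)}"
    unfolding P_singles
    by (rule order_trans[OF Poly_Mapping.keys_add] Un_least | simp add: squares_def)+
qed

lemma homogeneous_P: "homogeneous 2 P"
  using keys_P(2) by (auto simp: homogeneous_def squares_def)

text \<open>Mixed terms are strictly dominated, so only squares compete, and squaring preserves and
  reflects the order of the coordinates.\<close>

lemma maximal_terms_P:
  assumes "b \<noteq> (NegInf, NegInf, NegInf)"
  shows "maximal_terms P b = (\<lambda>m. m + m) ` leading_coords b"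
proof -
  obtain x y z where b: "b = (x, y, z)" by (cases b)
  have vals:
    "term_value P (2, 0, 0) b = x\<^sup>2" "term_value P (0, 2, 0) b = y\<^sup>2" "term_value P (0, 0, 2) b = z\<^sup>2"
    "term_value P (1, 1, 0) b = s21 * x * y" "term_value P (0, 1, 1) b = s32 * y * z"
    "term_value P (1, 0, 1) b = s31 * x * z"
    using lookup_P by (simp_all add: b)
  have "maximal_terms P b = {m \<in> squares. \<forall>n \<in> squares. term_value P n b \<le> term_value P m b}"
  proof (rule maximal_terms_dominated[OF keys_P(1)])
    fix n assume "n \<in> Poly_Mapping.keys P - squares"
    then have "n = (1, 1, 0) \<or> n = (0, 1, 1) \<or> n = (1, 0, 1)"
      using keys_P(2) by blast
    moreover have "s21 * x * y < x\<^sup>2 \<or> s21 * x * y < y\<^sup>2 \<or> s21 * x * y < z\<^sup>2"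
      using assms by (intro mixed_term_less neg) (simp add: b)
    moreover have "s32 * y * z < y\<^sup>2 \<or> s32 * y * z < z\<^sup>2 \<or> s32 * y * z < x\<^sup>2"
      using assms by (intro mixed_term_less neg) (auto simp: b)
    moreover have "s31 * x * z < x\<^sup>2 \<or> s31 * x * z < z\<^sup>2 \<or> s31 * x * z < y\<^sup>2"
      using assms by (intro mixed_term_less neg) (auto simp: b)
    ultimately have "term_value P n b < x\<^sup>2 \<or> term_value P n b < y\<^sup>2 \<or> term_value P n b < z\<^sup>2"
      by (metis vals(4-6))
    then show "\<exists>m \<in> squares. term_value P n b < term_value P m b"
      by (simp add: squares_def vals)
  qed
  also have "\<dots> = {m. m = (2, 0, 0) \<and> y\<^sup>2 \<le> x\<^sup>2 \<and> z\<^sup>2 \<le> x\<^sup>2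
      \<or> m = (0, 2, 0) \<and> x\<^sup>2 \<le> y\<^sup>2 \<and> z\<^sup>2 \<le> y\<^sup>2 \<or> m = (0, 0, 2) \<and> x\<^sup>2 \<le> z\<^sup>2 \<and> y\<^sup>2 \<le> z\<^sup>2}"
    unfolding squares_def vals(1-3)[symmetric] by auto
  also have "\<dots> = (\<lambda>m. m + m) ` leading_coords b"
    unfolding b double_leading_coords trop_square_le_iff ..
  finally show ?thesis .
qed

text \<open>The witness is the line with all coefficients 0: at each representative its maximal
  terms are as many as those of \<open>P\<close>.\<close>

lemma tropical_line_trop_curve_P: "tropical_line (trop_curve P)"
proof -
  let ?L = "const_poly (Fin 0) * varX + const_poly (Fin 0) * varY + const_poly (Fin 0) * varZ"
  have "card (maximal_terms P b) = card (maximal_terms ?L b)" if "q \<in> TP2" "b \<in> q" for q b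
  proof -
    \<comment> \<open>Projective classes lie inside the punctured space.\<close>
    have "b \<noteq> (NegInf, NegInf, NegInf)"
      using that in_quotient_imp_subset[OF equiv_proj_rel] unfolding TP2_def by blast
    then show ?thesis
      unfolding maximal_terms_line
      by (simp add: maximal_terms_P card_image inj_on_subset[OF inj_double])
  qed
  then have "trop_curve P = trop_curve ?L"
    unfolding trop_curve_def by (intro Collect_cong conj_cong bex_cong) auto
  then show ?thesis unfolding tropical_line_def by blast
qed

section \<open>Edges and their multiplicities\<close>

lemma chart_terms_P: "chart_terms P w = (\<lambda>m. m + m) ` leading_coords (Fin (fst w), Fin (snd w), Fin 0)"
  by (simp add: chart_terms_def maximal_terms_P leading_coords_def)

end

section \<open>Relative interiors of cells and lattice lengths\<close>

text \<open>Near \<open>w\<close> the cell fills the affine set \<open>A\<close> that contains it,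
  so \<open>w\<close> is a relative interior point. All points of the cell carry at least the terms
  of \<open>w\<close>, and \<open>w\<close> itself carries no others.\<close>

lemma generic_terms_of_cell:
  assumes "\<And>v. v \<in> cell p w \<Longrightarrow> v \<in> A" and "affine A"
    and "open U" and "w \<in> U" and "\<And>v. v \<in> U \<inter> A \<Longrightarrow> v \<in> cell p w"
  shows "{m. \<forall>v \<in> rel_interior (cell p w). m \<in> chart_terms p v} = chart_terms p w"
proof -
  have "affine hull cell p w \<subseteq> A"
    using assms(1,2) by (simp add: hull_minimal subsetI)
  moreover have "w \<in> cell p w" by (simp add: cell_def)
  ultimately have "w \<in> rel_interior (cell p w)"
    using assms(3,4,5) unfolding rel_interior by (intro CollectI conjI exI[of _ U]) auto
  moreover have "chart_terms p w \<subseteq> chart_terms p v" if "v \<in> rel_interior (cell p w)" for v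
    using that rel_interior_subset[of "cell p w"] unfolding cell_def by blast
  ultimately show ?thesis by blast
qed

text \<open>A one-dimensional cell is neither full-dimensional nor a point; this will exclude the
  open sectors and the vertex.\<close>

lemma edge_cellE:
  assumes "e \<in> edges p"
  obtains w where "e = cell p w" and "interior (cell p w) = {}" and "cell p w \<noteq> {w}"
proof -
  obtain w where w: "e = cell p w" "aff_dim (cell p w) = 1"
    using assms by (auto simp: edges_def)
  have "interior (cell p w) = {}"
  proof (rule ccontr)
    assume "interior (cell p w) \<noteq> {}"
    from aff_dim_nonempty_interior[OF this] w(2) show False by simp
  qed
  moreover have "cell p w \<noteq> {w}" using w(2) by (metis aff_dim_sing zero_neq_one)
  ultimately show thesis using that w(1) by blast
qed

text \<open>The lattice points are the two ends and the midpoint: three points, hence length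
  two.\<close>

lemma lattice_length_segment_2:
  fixes a b :: "real \<times> real \<times> real"
  assumes "a \<noteq> b"
    and lattice: "\<And>u. (1 - u) *\<^sub>R a + u *\<^sub>R b \<in> \<int> \<times> \<int> \<times> \<int> \<longleftrightarrow> 2 * u \<in> \<int>"
  shows "lattice_length (closed_segment a b) = 2"
proof -
  define f where "f = (\<lambda>u. (1 - u) *\<^sub>R a + u *\<^sub>R b)"
  have half_integers: "u \<in> {0, 1 / 2, 1}" if u: "0 \<le> u" "u \<le> 1" "2 * u \<in> \<int>" for u :: real
  proof -
    obtain k :: int where k: "2 * u = of_int k" using u(3) by (rule Ints_cases)
    with u have "0 \<le> real_of_int k" "real_of_int k \<le> 2" by linarith+
    then have "0 \<le> k" "k \<le> 2" by linarith+
    then have "k = 0 \<or> k = 1 \<or> k = 2" by arith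
    with k show ?thesis by (elim disjE) simp_all
  qed
  have "f ` A \<inter> B = f ` {u \<in> A. f u \<in> B}" for A B
    by blast
  then have "closed_segment a b \<inter> (\<int> \<times> \<int> \<times> \<int>) = f ` {u \<in> {0..1}. f u \<in> \<int> \<times> \<int> \<times> \<int>}"
    unfolding closed_segment_image_interval f_def[symmetric] .
  also have "{u \<in> {0..1}. f u \<in> \<int> \<times> \<int> \<times> \<int>} = {u \<in> {0..1}. 2 * u \<in> \<int>}"
    unfolding f_def lattice ..
  also have "\<dots> = {0, 1 / 2, 1}"
  proof
    show "{u \<in> {0..1}. 2 * u \<in> \<int>} \<subseteq> {0, 1 / 2, 1 :: real}"
      by (rule subsetI) (metis (mono_tags, lifting) half_integers atLeastAtMost_iff mem_Collect_eq)
    show "{0, 1 / 2, 1 :: real} \<subseteq> {u \<in> {0..1}. 2 * u \<in> \<int>}" by simp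
  qed
  finally have "closed_segment a b \<inter> (\<int> \<times> \<int> \<times> \<int>) = f ` {0, 1 / 2, 1}" .
  moreover have "inj f"
  proof (rule injI)
    fix u v assume "f u = f v"
    moreover have "f u - f v = (u - v) *\<^sub>R (b - a)" by (simp add: f_def algebra_simps)
    ultimately have "(u - v) *\<^sub>R (b - a) = 0" by simp
    then show "u = v" using \<open>a \<noteq> b\<close> by simp
  qed
  then have "card (f ` {0, 1 / 2, 1}) = card {0, 1 / 2, 1 :: real}"
    by (meson card_image inj_on_subset subset_UNIV)
  ultimately show ?thesis by (simp add: lattice_length_def)
qed

text \<open>Along the segment the coordinates are 2u, 2(1 - u) and 0 in some order. The midpoint is
  the exponent of a mixed monomial, which counts as a lattice point although that term never attains
  the maximum.\<close>

lemma lattice_length_square_terms: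
  assumes "m \<in> squares" and "n \<in> squares" and "m \<noteq> n"
  shows "lattice_length (convex hull (exponent_vector ` {m, n})) = 2"
proof -
  have iff: "(1 - u) * 2 \<in> \<int> \<longleftrightarrow> 2 * u \<in> \<int>" "u * 2 \<in> \<int> \<longleftrightarrow> 2 * u \<in> \<int>" for u :: real
    using Ints_diff[of 2 "2 * u"] Ints_diff[of 2 "(1 - u) * 2"]
    by (simp_all add: left_diff_distrib mult.commute)
  have "lattice_length (closed_segment (exponent_vector m) (exponent_vector n)) = 2"
    using assms
    by (intro lattice_length_segment_2) (auto simp: squares_def exponent_vector_def iff)
  then show ?thesis by (simp add: segment_convex_hull)
qed

context conic
begin

lemma multiplicity_edge:
  assumes "e \<in> edges P"
  shows "multiplicity P e = 2"
proof -
  obtain w where e: "e = cell P w" and int: "interior (cell P w) = {}" and nonpoint: "cell P w \<noteq> {w}"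
    using edge_cellE[OF assms] .
  obtain x y where w: "w = (x, y)" by (cases w)
  have open_cell: False if "open U" "w \<in> U" "U \<subseteq> cell P w" for U
    using that int interior_maximal by blast
  \<comment> \<open>A point lies in the cell iff every coordinate that is largest in (x, y, 0) is
    also largest in (x', y', 0).\<close>
  have cell: "(x', y') \<in> cell P w \<longleftrightarrow> (y \<le> x \<and> 0 \<le> x \<longrightarrow> y' \<le> x' \<and> 0 \<le> x')
      \<and> (x \<le> y \<and> 0 \<le> y \<longrightarrow> x' \<le> y' \<and> 0 \<le> y') \<and> (x \<le> 0 \<and> y \<le> 0 \<longrightarrow> x' \<le> 0 \<and> y' \<le> 0)" for x' y'
    by (simp add: cell_def chart_terms_P w inj_image_subset_iff[OF inj_double] leading_coords_subset_iff)
      (simp add: leading_coords_def)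
  have edge: ?thesis
    if "chart_terms P w = {m, n}" "m \<in> squares" "n \<in> squares" "m \<noteq> n"
      and "\<And>v. v \<in> cell P w \<Longrightarrow> v \<in> A" "affine A" "open U" "w \<in> U"
      and "\<And>v. v \<in> U \<inter> A \<Longrightarrow> v \<in> cell P w" for m n A U
    using lattice_length_square_terms[OF that(2-4)] generic_terms_of_cell[OF that(5-9)] that(1)
    by (simp add: multiplicity_def e)
  \<comment> \<open>The cases record which of x, y, 0 are largest: one alone in an open sector, all
    three at the vertex, exactly two on a ray.\<close>
  consider "y < x" "0 < x" | "x < y" "0 < y" | "x < 0" "y < 0" | "x = 0" "y = 0"
    | "x = y" "0 < x" | "x = 0" "y < 0" | "y = 0" "x < 0"
    by linarith
  then show ?thesis
  proof cases
    case 1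
    let ?U = "{v :: real \<times> real. snd v < fst v \<and> 0 < fst v}"
    have "open ?U"
      by (intro open_Collect_conj open_Collect_less continuous_intros)
    moreover have "w \<in> ?U" "?U \<subseteq> cell P w"
      using 1 by (simp add: w) (use 1 in \<open>auto simp: cell\<close>)
    ultimately have False by (rule open_cell)
    then show ?thesis ..
  next
    case 2
    let ?U = "{v :: real \<times> real. fst v < snd v \<and> 0 < snd v}"
    have "open ?U"
      by (intro open_Collect_conj open_Collect_less continuous_intros)
    moreover have "w \<in> ?U" "?U \<subseteq> cell P w"
      using 2 by (simp add: w) (use 2 in \<open>auto simp: cell\<close>)
    ultimately have False by (rule open_cell)
    then show ?thesis ..
  next
    case 3
    let ?U = "{v :: real \<times> real. fst v < 0 \<and> snd v < 0}"
    have "open ?U"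
      by (intro open_Collect_conj open_Collect_less continuous_intros)
    moreover have "w \<in> ?U" "?U \<subseteq> cell P w"
      using 3 by (simp add: w) (use 3 in \<open>auto simp: cell\<close>)
    ultimately have False by (rule open_cell)
    then show ?thesis ..
  next
    case 4
    then have "v = w" if "v \<in> cell P w" for v
      using that cell[of "fst v" "snd v"] by (cases v) (simp add: w)
    moreover have "w \<in> cell P w" by (simp add: cell_def)
    ultimately show ?thesis using nonpoint by blast
  next
    case 5
    show ?thesis
    \<comment> \<open>\<open>A\<close> is the line spanned by the ray, and \<open>U\<close> is an
      open half-plane around \<open>w\<close> that cuts the ray without its vertex out of
      \<open>A\<close>; the other two rays are treated alike.\<close>
    proof (rule edge)
      show "chart_terms P w = {(2, 0, 0), (0, 2, 0)}"
        using 5 by (auto simp: chart_terms_P w leading_coords_def Collect_disj_eq)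
      show "affine {v :: real \<times> real. fst v = snd v}"
        by (simp add: affine_def)
      show "open {v :: real \<times> real. 0 < fst v}"
        by (intro open_Collect_less continuous_intros)
      show "w \<in> {v :: real \<times> real. 0 < fst v}"
        using 5 by (simp add: w)
    qed (use 5 in \<open>auto simp: squares_def cell\<close>)
  next
    case 6
    show ?thesis
    proof (rule edge)
      show "chart_terms P w = {(2, 0, 0), (0, 0, 2)}"
        using 6 by (auto simp: chart_terms_P w leading_coords_def Collect_disj_eq)
      show "affine {v :: real \<times> real. fst v = 0}"
        by (simp add: affine_def)
      show "open {v :: real \<times> real. snd v < 0}"
        by (intro open_Collect_less continuous_intros)
      show "w \<in> {v :: real \<times> real. snd v < 0}"
        using 6 by (simp add: w)
    qed (use 6 in \<open>auto simp: squares_def cell\<close>)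
  next
    case 7
    show ?thesis
    proof (rule edge)
      show "chart_terms P w = {(0, 2, 0), (0, 0, 2)}"
        using 7 by (auto simp: chart_terms_P w leading_coords_def Collect_disj_eq)
      show "affine {v :: real \<times> real. snd v = 0}"
        by (simp add: affine_def)
      show "open {v :: real \<times> real. fst v < 0}"
        by (intro open_Collect_less continuous_intros)
      show "w \<in> {v :: real \<times> real. fst v < 0}"
        using 7 by (simp add: w)
    qed (use 7 in \<open>auto simp: squares_def cell\<close>)
  qed
qed

end

theorem corollary5:
  fixes s21 s32 s31 :: trop and P :: trop_poly
  assumes "s21 < Fin 0" and "s32 < Fin 0" and "s31 < Fin 0"
    and "P = varX ^ 2 + varY ^ 2 + varZ ^ 2 + const_poly s21 * varX * varY
             + const_poly s32 * varY * varZ + const_poly s31 * varX * varZ"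
  shows "trop_irreducible P \<and> double_line P"
proof -
  interpret conic s21 s32 s31 P using assms by unfold_locales
  have "trop_irreducible P"
    using lookup_P neg homogeneous_P by (intro conic_irreducible) simp_all
  then show ?thesis
    using homogeneous_P tropical_line_trop_curve_P multiplicity_edge by (simp add: double_line_def)
qed

end
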